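(* Let $d=1$. If $Y\in\mathrm{St}(1,p)^m$ is selected uniformly at random, then, almost surely, $\dim\mathcal{F}_{YY^\top}=\max(0,\Delta)$, where $\Delta=\frac{p(p+1)}{2}-m\frac{d(d+1)}{2}=\frac{p(p+1)}{2}-m$.
   Context: Here $d=1$, $n=m$ and $1\le p\le n$. $\mathrm{St}(1,p)^m$ is the set of matrices $Y\in\mathbb{R}^{m\times p}$ whose rows all have unit Euclidean norm (a product of $m$ unit spheres of $\mathbb{R}^p$); uniformly at random means that the rows are independent and each uniformly distributed on the unit sphere of $\mathbb{R}^p$. Define $\mathcal{C}=\{X\in\mathbb{R}^{m\times m}: X=X^\top,\ X\succeq 0,\ X_{ii}=1,\ i=1,\dots,m\}$. A face of $\mathcal{C}$ is a convex subset $\mathcal{F}\subseteq\mathcal{C}$ such that every closed line segment in $\mathcal{C}$ with a relative interior point in $\mathcal{F}$ has both endpoints in $\mathcal{F}$. For $X\in\mathcal{C}$, $\mathcal{F}_X$ is the unique face of $\mathcal{C}$ containing $X$ in its relative interior. Explicitly, if $X=ZZ^\top$ with $Z\in\mathbb{R}^{m\times r}$, $r=\operatorname{rank}(X)$, and $z_1,\dots,z_m\in\mathbb{R}^r$ are the (transposed) rows of $Z$, then $\mathcal{F}_X=\{Z(I_r+A)Z^\top: A\in\mathbb{R}^{r\times r}\text{ symmetric},\ z_i^\top Az_i=0\ (i=1,\dots,m),\ I_r+A\succeq 0\}$, and $\dim\mathcal{F}_X$ is the dimension of the space of symmetric $r\times r$ matrices $A$ with $z_i^\top Az_i=0$ for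 all $i$. *)

theory Defs
  imports "HOL-Analysis.Analysis" "HOL-Probability.Probability"
begin

definition psd_matrix :: "real^'n^'n \<Rightarrow> bool"
  where "psd_matrix X \<longleftrightarrow> (\<forall>v. 0 \<le> v \<bullet> (X *v v))"

definition elliptope :: "(real^'n^'n) set"
  where "elliptope = {X. transpose X = X \<and> psd_matrix X \<and> (\<forall>i. X $ i $ i = 1)}"

definition minimal_face :: "'a::euclidean_space set \<Rightarrow> 'a \<Rightarrow> 'a set"
  where "minimal_face S x = (THE F. F face_of S \<and> x \<in> rel_interior F)"

text \<open>The radial projection of the uniform distribution on the unit ball is the normalized
  surface measure of the unit sphere (the origin, where \<open>sgn\<close> vanishes, is a null set).
  For \<open>DIM('a) = 1\<close> it is the fair coin on the two unit vectors.\<close>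

definition uniform_sphere :: "'a::euclidean_space measure"
  where "uniform_sphere = distr (uniform_measure lborel (ball 0 1)) borel sgn"

lemma convex_elliptope: "convex (elliptope :: (real^'n^'n) set)"
proof (rule convexI)
  fix X Y :: "real^'n^'n" and u v :: real
  assume XY: "X \<in> elliptope" "Y \<in> elliptope" and uv: "0 \<le> u" "0 \<le> v" "u + v = 1"
  have "transpose (u *\<^sub>R X + v *\<^sub>R Y) = u *\<^sub>R transpose X + v *\<^sub>R transpose Y"
    by (simp add: transpose_def vec_eq_iff)
  moreover have "w \<bullet> ((u *\<^sub>R X + v *\<^sub>R Y) *v w) = u * (w \<bullet> (X *v w)) + v * (w \<bullet> (Y *v w))" for w
    by (simp add: matrix_vector_mult_add_rdistrib inner_right_distrib
        flip: scaleR_matrix_vector_assoc)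
  ultimately show "u *\<^sub>R X + v *\<^sub>R Y \<in> elliptope"
    using XY uv by (auto simp: elliptope_def psd_matrix_def)
qed

lemma ex1_minimal_face:
  fixes S :: "'a::euclidean_space set"
  assumes S: "convex S" and x: "x \<in> S"
  shows "\<exists>!F. F face_of S \<and> x \<in> rel_interior F"
proof (rule ex_ex1I)
  define P where "P F \<longleftrightarrow> F face_of S \<and> x \<in> F" for F
  have "P S"
    using S x by (simp add: P_def face_of_refl)
  then obtain F where F: "P F" and least: "\<And>G. P G \<Longrightarrow> nat (aff_dim F) \<le> nat (aff_dim G)"
    using ex_has_least_nat[of P S "\<lambda>F. nat (aff_dim F)"] by blast
  have cF: "convex F" and FS: "F face_of S" and xF: "x \<in> F"
    using F by (auto simp: P_def face_of_imp_convex)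
  have "x \<in> rel_interior F"
  proof (rule ccontr)
    assume x': "x \<notin> rel_interior F"
    obtain a where a: "\<And>y. y \<in> F \<Longrightarrow> a \<bullet> x \<le> a \<bullet> y"
        "\<And>y. y \<in> rel_interior F \<Longrightarrow> a \<bullet> x < a \<bullet> y"
      using supporting_hyperplane_rel_boundary[OF cF xF x'] by metis
    define G where "G = F \<inter> {y. a \<bullet> y = a \<bullet> x}"
    have G: "G face_of F"
      unfolding G_def using cF a(1) by (intro face_of_Int_supporting_hyperplane_ge) auto
    have xG: "x \<in> G"
      using xF by (simp add: G_def)
    obtain y where "y \<in> rel_interior F"
      using cF xF rel_interior_eq_empty by blast
    then have "G \<noteq> F"
      using a(2)[of y] rel_interior_subset[of F] unfolding G_def by force
    then have "aff_dim G < aff_dim F"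
      using face_of_aff_dim_lt[OF cF G] by blast
    moreover have "P G"
      using G FS xG face_of_trans by (auto simp: P_def)
    moreover have "0 \<le> aff_dim G"
      using xG by (metis aff_dim_eq_full aff_dim_geq aff_dim_negative_iff empty_iff not_less)
    ultimately show False
      using least[of G] by simp
  qed
  then show "\<exists>F. F face_of S \<and> x \<in> rel_interior F"
    using FS by blast
qed (use face_of_eq in blast)

lemma minimal_face:
  fixes S :: "'a::euclidean_space set"
  assumes "convex S" "x \<in> S"
  shows "minimal_face S x face_of S" "x \<in> rel_interior (minimal_face S x)"
  using theI'[OF ex1_minimal_face[OF assms]] by (simp_all add: minimal_face_def)

lemma sets_uniform_sphere [simp, measurable_cong]: "sets uniform_sphere = sets borel"
  by (simp add: uniform_sphere_def)

lemma space_uniform_sphere [simp]: "space uniform_sphere = UNIV"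
  by (simp add: uniform_sphere_def)

lemma emeasure_lborel_unit_ball:
  "emeasure lborel (ball (0::'a::euclidean_space) 1) \<noteq> 0"
  "emeasure lborel (ball (0::'a::euclidean_space) 1) \<noteq> \<infinity>"
  using content_ball_pos[of 1 "0::'a"] emeasure_lborel_ball_finite[of "0::'a" 1]
  by (auto simp: measure_def)

lemma prob_space_uniform_sphere: "prob_space (uniform_sphere :: 'a::euclidean_space measure)"
  unfolding uniform_sphere_def
  by (intro prob_space.prob_space_distr prob_space_uniform_measure emeasure_lborel_unit_ball) simp

lemma emeasure_uniform_sphere:
  assumes B: "B \<in> sets borel"
  shows "emeasure uniform_sphere B =
    emeasure lborel (ball (0::'a::euclidean_space) 1 \<inter> sgn -` B) / emeasure lborel (ball (0::'a) 1)"
proof -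
  have "sgn -` B \<in> sets borel"
    using measurable_sets[OF borel_measurable_sgn B] by simp
  then show ?thesis
    using B by (simp add: uniform_sphere_def emeasure_distr)
qed

lemma AE_uniform_sphere_norm: "AE x in uniform_sphere. norm (x::'a::euclidean_space) = 1"
proof -
  have "AE x in lborel. x \<noteq> (0::'a)"
    by (rule AE_lborel_singleton)
  then have "AE x in uniform_measure lborel (ball (0::'a) 1). norm (sgn x) = 1"
    by (intro AE_uniform_measureI) (auto simp: norm_sgn)
  then show ?thesis
    unfolding uniform_sphere_def by (subst AE_distr_iff) auto
qed

lemma uniform_sphere_rotation_invariant:
  fixes f :: "real^'n::{finite,wellorder} \<Rightarrow> real^'n::_"
  assumes f: "orthogonal_transformation f"
  shows "distr uniform_sphere borel f = uniform_sphere"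
proof (rule measure_eqI)
  fix B :: "(real^'n::_) set"
  assume "B \<in> sets (distr uniform_sphere borel f)"
  then have B: "B \<in> sets borel"
    by simp
  have lin: "linear f"
    using f by (rule orthogonal_transformation_linear)
  have meas: "f \<in> borel_measurable borel"
    by (intro borel_measurable_continuous_onI linear_continuous_on
        linear_conv_bounded_linear[THEN iffD1] lin)
  have fB: "f -` B \<in> sets borel"
    using measurable_sets[OF meas B] by simp
  have sgnf: "sgn (f x) = f (sgn x)" for x
    using f lin by (simp add: sgn_div_norm orthogonal_transformation_norm linear_scale)
  define U where "U C = ball 0 1 \<inter> sgn -` C" for C :: "(real^'n::_) set"
  have U: "U C \<in> sets borel" if "C \<in> sets borel" for C
    unfolding U_def using measurable_sets[OF borel_measurable_sgn that] by auto
  have Ulm: "U C \<in> lmeasurable" if "C \<in> sets borel" for C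
  proof (rule bounded_set_imp_lmeasurable)
    show "bounded (U C)"
      unfolding U_def by (rule bounded_Int) (simp add: bounded_ball)
    show "U C \<in> sets lebesgue"
      using U[OF that] sets_completionI_sets[of "U C" lborel] by simp
  qed
  have "f ` U (f -` B) = U B"
  proof
    show "f ` U (f -` B) \<subseteq> U B"
      using f by (auto simp: U_def sgnf orthogonal_transformation_norm)
    show "U B \<subseteq> f ` U (f -` B)"
    proof
      fix y assume y: "y \<in> U B"
      obtain x where "y = f x"
        using orthogonal_transformation_surj[OF f] by (metis surjD)
      then show "y \<in> f ` U (f -` B)"
        using y f by (auto simp: U_def sgnf orthogonal_transformation_norm)
    qed
  qed
  then have "measure lebesgue (U (f -` B)) = measure lebesgue (U B)"
    using measure_orthogonal_image[OF f Ulm[OF fB]] by simp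
  then have "emeasure lebesgue (U (f -` B)) = emeasure lebesgue (U B)"
    using emeasure_eq_measure2[OF Ulm[OF fB]] emeasure_eq_measure2[OF Ulm[OF B]] by metis
  moreover have "emeasure lebesgue (U C) = emeasure lborel (U C)" if "C \<in> sets borel" for C
    using U[OF that] by simp
  ultimately have *: "emeasure lborel (U (f -` B)) = emeasure lborel (U B)"
    using B fB by metis
  have "f \<in> measurable uniform_sphere borel"
    using meas by (simp cong: measurable_cong_sets)
  then have "emeasure (distr uniform_sphere borel f) B = emeasure uniform_sphere (f -` B)"
    using B by (simp add: emeasure_distr)
  then show "emeasure (distr uniform_sphere borel f) B = emeasure uniform_sphere B"
    using B fB * by (simp add: emeasure_uniform_sphere U_def)
qed simp

end

(* The tangent directions of the elliptope at X = Y Y^T are the matrices Y A Y^T with A symmetric and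
   orthogonal to every y_i y_i^T, so for Y of full column rank the dimension of the minimal face is
   p(p+1)/2 minus the dimension of the span of the y_i y_i^T. Independent random vectors in a space V
   that almost surely avoid each fixed hyperplane of V are almost surely in general position; this
   applies to the y_i in R^p and to the y_i y_i^T in the symmetric matrices, because a nonzero
   quadratic form vanishes only on a null set. *)
theory Submission
  imports Defs
begin

section \<open>Independent random vectors and general position\<close>

text \<open>Independence makes the joint law a product measure, so Fubini allows \<open>X\<close> to
  be frozen at a value \<open>x\<close>; measurability of \<open>P\<close> in both arguments jointly
  is what makes the exceptional set accessible to Fubini.\<close>

lemma (in prob_space) AE_indep_var:
  assumes ind: "indep_var S X T Y"
    and P: "Measurable.pred (S \<Otimes>\<^sub>M T) (\<lambda>z. P (fst z) (snd z))"
    and ae: "\<And>x. x \<in> space S \<Longrightarrow> AE \<omega> in M. P x (Y \<omega>)"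
  shows "AE \<omega> in M. P (X \<omega>) (Y \<omega>)"
proof -
  have X [measurable]: "random_variable S X" and Y [measurable]: "random_variable T Y"
    and eq: "distr M S X \<Otimes>\<^sub>M distr M T Y = distr M (S \<Otimes>\<^sub>M T) (\<lambda>\<omega>. (X \<omega>, Y \<omega>))"
    using ind by (auto simp: indep_var_distribution_eq)
  interpret D1: prob_space "distr M S X" by (rule prob_space_distr) simp
  interpret D2: prob_space "distr M T Y" by (rule prob_space_distr) simp
  interpret pair_sigma_finite "distr M S X" "distr M T Y" ..
  have "AE z in distr M S X \<Otimes>\<^sub>M distr M T Y. P (fst z) (snd z)"
  proof (rule AE_pair_measure)
    show "{z \<in> space (distr M S X \<Otimes>\<^sub>M distr M T Y). P (fst z) (snd z)}
        \<in> sets (distr M S X \<Otimes>\<^sub>M distr M T Y)"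
      using predE[OF P] by (simp add: space_pair_measure cong: sets_pair_measure_cong)
    show "AE x in distr M S X. AE y in distr M T Y. P (fst (x, y)) (snd (x, y))"
    proof (rule AE_I2)
      fix x assume "x \<in> space (distr M S X)"
      then have x: "x \<in> space S"
        by simp
      have "Measurable.pred T (P x)"
        using measurable_compose[OF measurable_Pair1'[OF x, of T] P] by simp
      then show "AE y in distr M T Y. P (fst (x, y)) (snd (x, y))"
        using ae[OF x] by (simp add: AE_distr_iff pred_def)
    qed
  qed
  then have "AE z in distr M (S \<Otimes>\<^sub>M T) (\<lambda>\<omega>. (X \<omega>, Y \<omega>)). P (fst z) (snd z)"
    by (simp only: eq)
  then show ?thesis
    using P by (subst (asm) AE_distr_iff) (auto simp: pred_def)
qed

text \<open>Coefficients are attached to indices rather than to vectors, so that repeated values of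
  \<open>x\<close> cause no trouble.\<close>

lemma span_image_subset_range:
  assumes I: "finite I"
  shows "span (x ` I) \<subseteq> range (\<lambda>c. \<Sum>j\<in>I. c j *\<^sub>R x j)"
proof (rule span_minimal)
  show "x ` I \<subseteq> range (\<lambda>c. \<Sum>j\<in>I. c j *\<^sub>R x j)"
  proof
    fix y assume "y \<in> x ` I"
    then obtain i where "i \<in> I" "y = x i"
      by blast
    then have "y = (\<Sum>j\<in>I. of_bool (j = i) *\<^sub>R x j)"
      using I by (simp add: of_bool_def if_distrib[of "\<lambda>a. a *\<^sub>R _"] cong: if_cong)
    then show "y \<in> range (\<lambda>c. \<Sum>j\<in>I. c j *\<^sub>R x j)"
      by (intro range_eqI[of _ _ "\<lambda>j. of_bool (j = i)"])
  qed
  show "subspace (range (\<lambda>c. \<Sum>j\<in>I. c j *\<^sub>R x j))"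
    unfolding subspace_def
  proof (intro conjI ballI allI)
    show "0 \<in> range (\<lambda>c. \<Sum>j\<in>I. c j *\<^sub>R x j)"
      by (rule range_eqI[of _ _ "\<lambda>_. 0"]) simp
  next
    fix u v assume "u \<in> range (\<lambda>c. \<Sum>j\<in>I. c j *\<^sub>R x j)" "v \<in> range (\<lambda>c. \<Sum>j\<in>I. c j *\<^sub>R x j)"
    then obtain a b where "u = (\<Sum>j\<in>I. a j *\<^sub>R x j)" "v = (\<Sum>j\<in>I. b j *\<^sub>R x j)"
      by blast
    then show "u + v \<in> range (\<lambda>c. \<Sum>j\<in>I. c j *\<^sub>R x j)"
      by (intro range_eqI[of _ _ "\<lambda>j. a j + b j"]) (simp add: scaleR_add_left sum.distrib)
  next
    fix r u assume "u \<in> range (\<lambda>c. \<Sum>j\<in>I. c j *\<^sub>R x j)"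
    then obtain a where "u = (\<Sum>j\<in>I. a j *\<^sub>R x j)"
      by blast
    then show "r *\<^sub>R u \<in> range (\<lambda>c. \<Sum>j\<in>I. c j *\<^sub>R x j)"
      by (intro range_eqI[of _ _ "\<lambda>j. r * a j"]) (simp add: scaleR_sum_right)
  qed
qed

text \<open>Serves to prove measurability: all quantifiers on the right range over countable sets,
  since functions in \<open>I \<rightarrow>\<^sub>E \<rat>\<close> are fixed outside the finite set
  \<open>I\<close>. Rational coefficients suffice by density, and approximation implies membership
  because a subspace of a Euclidean space is closed.\<close>

lemma mem_span_image_iff_rational_approx:
  fixes x :: "'i \<Rightarrow> 'a::euclidean_space"
  assumes I: "finite I"
  shows "v \<in> span (x ` I) \<longleftrightarrow>
    (\<forall>n. \<exists>c \<in> I \<rightarrow>\<^sub>E \<rat>. norm ((\<Sum>j\<in>I. c j *\<^sub>R x j) - v) < 1 / real (Suc n))"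
proof (intro iffI allI)
  fix n
  assume "v \<in> span (x ` I)"
  then obtain c where v: "v = (\<Sum>j\<in>I. c j *\<^sub>R x j)"
    using span_image_subset_range[OF I, of x] by blast
  have "\<exists>q. (\<forall>n. q n \<in> \<rat>) \<and> q \<longlonglongrightarrow> c j" for j
    using Rats_closure_real by (metis UNIV_I closure_sequential)
  then obtain q where q: "\<And>j n. q j n \<in> \<rat>" "\<And>j. q j \<longlonglongrightarrow> c j"
    by metis
  have "(\<lambda>n. (\<Sum>j\<in>I. q j n *\<^sub>R x j) - v) \<longlonglongrightarrow> (\<Sum>j\<in>I. c j *\<^sub>R x j) - v"
    by (intro tendsto_intros q)
  then have "(\<lambda>n. (\<Sum>j\<in>I. q j n *\<^sub>R x j) - v) \<longlonglongrightarrow> 0"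
    by (simp add: v)
  then obtain k where k: "norm ((\<Sum>j\<in>I. q j k *\<^sub>R x j) - v) < 1 / real (Suc n)"
    using LIMSEQ_D[of _ 0 "1 / real (Suc n)"] by force
  show "\<exists>c \<in> I \<rightarrow>\<^sub>E \<rat>. norm ((\<Sum>j\<in>I. c j *\<^sub>R x j) - v) < 1 / real (Suc n)"
    using k q(1) by (intro bexI[of _ "restrict (\<lambda>j. q j k) I"]) auto
next
  assume approx: "\<forall>n. \<exists>c \<in> I \<rightarrow>\<^sub>E \<rat>. norm ((\<Sum>j\<in>I. c j *\<^sub>R x j) - v) < 1 / real (Suc n)"
  have "v \<in> closure (span (x ` I))"
    unfolding closure_approachable
  proof (intro allI impI)
    fix e :: real assume "0 < e"
    then obtain n where n: "1 / real (Suc n) < e"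
      using nat_approx_posE by blast
    obtain c where "norm ((\<Sum>j\<in>I. c j *\<^sub>R x j) - v) < 1 / real (Suc n)"
      using approx by blast
    then have "dist (\<Sum>j\<in>I. c j *\<^sub>R x j) v < e"
      using n by (simp add: dist_norm)
    then show "\<exists>y\<in>span (x ` I). dist y v < e"
      by (intro bexI[of _ "\<Sum>j\<in>I. c j *\<^sub>R x j"] span_sum span_scale span_base) auto
  qed
  then show "v \<in> span (x ` I)"
    by (simp add: closed_subspace closure_closed)
qed

text \<open>Once the vectors indexed by \<open>I\<close> are frozen, their span is a fixed subspace
  of dimension at most \<open>card I\<close>, to which \<open>null\<close> applies.\<close>

lemma (in prob_space) AE_not_in_span_of_indep:
  fixes Z :: "'i \<Rightarrow> 'a \<Rightarrow> 'b::euclidean_space"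
  assumes ind: "indep_vars (\<lambda>_. borel) Z J" and I: "finite I" "insert i I \<subseteq> J" "i \<notin> I"
    and null: "\<And>W. \<lbrakk>subspace W; dim W \<le> card I\<rbrakk> \<Longrightarrow> AE \<omega> in M. Z i \<omega> \<notin> W"
  shows "AE \<omega> in M. Z i \<omega> \<notin> span ((\<lambda>j. Z j \<omega>) ` I)"
proof -
  \<comment> \<open>The vector \<open>Z i\<close> is treated as a block over the index set
    \<open>{i}\<close>, so that independence of disjoint blocks of the family applies.\<close>
  have "indep_var (PiM I (\<lambda>_. borel)) (\<lambda>\<omega>. restrict (\<lambda>j. Z j \<omega>) I)
      (PiM {i} (\<lambda>_. borel)) (\<lambda>\<omega>. restrict (\<lambda>j. Z j \<omega>) {i})"
    using I by (intro indep_var_restrict[OF ind]) auto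
  moreover have "Measurable.pred (PiM I (\<lambda>_. borel) \<Otimes>\<^sub>M PiM {i} (\<lambda>_. borel))
      (\<lambda>z. (snd z i :: 'b) \<notin> span (fst z ` I))"
  proof -
    let ?N = "PiM I (\<lambda>_. borel :: 'b measure) \<Otimes>\<^sub>M PiM {i} (\<lambda>_. borel :: 'b measure)"
    have cnt: "countable (I \<rightarrow>\<^sub>E (\<rat>::real set))"
      using I countable_rat by (intro countable_PiE) auto
    have "Measurable.pred ?N
        (\<lambda>z. \<forall>n. \<exists>c \<in> I \<rightarrow>\<^sub>E \<rat>. norm ((\<Sum>j\<in>I. c j *\<^sub>R fst z j) - snd z i) < 1 / real (Suc n))"
    proof (rule pred_intros_countable)
      fix n
      have "Measurable.pred ?N
          (\<lambda>z. norm ((\<Sum>j\<in>I. c j *\<^sub>R fst z j) - snd z i) < 1 / real (Suc n))" for c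
        by measurable
      then show "Measurable.pred ?N
          (\<lambda>z. \<exists>c \<in> I \<rightarrow>\<^sub>E \<rat>. norm ((\<Sum>j\<in>I. c j *\<^sub>R fst z j) - snd z i) < 1 / real (Suc n))"
        unfolding pred_def by (intro sets.sets_Collect_countable_Ex' cnt) auto
    qed
    then have "Measurable.pred ?N (\<lambda>z. snd z i \<in> span (fst z ` I))"
      by (simp only: mem_span_image_iff_rational_approx[OF I(1)])
    then show ?thesis
      by measurable
  qed
  moreover have "AE \<omega> in M. restrict (\<lambda>j. Z j \<omega>) {i} i \<notin> span (x ` I)" for x
    using I(1) by (simp add: null order_trans[OF dim_le_card'] card_image_le)
  ultimately have "AE \<omega> in M. restrict (\<lambda>j. Z j \<omega>) {i} i \<notin> span (restrict (\<lambda>j. Z j \<omega>) I ` I)"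
    by (rule AE_indep_var[where P = "\<lambda>x y. y i \<notin> span (x ` I)"])
  then show ?thesis by simp
qed

text \<open>The subspace \<open>V\<close> is kept apart from the ambient type because the symmetric
  matrices form only a subspace of all matrices. The upper bounds are immediate; for the lower one,
  a fixed index set of the expected size almost surely yields independent vectors.\<close>

lemma (in prob_space) AE_dim_range_indep:
  fixes Z :: "'i::finite \<Rightarrow> 'a \<Rightarrow> 'b::euclidean_space"
  assumes ind: "indep_vars (\<lambda>_. borel) Z UNIV" and V: "subspace V" "\<And>i \<omega>. Z i \<omega> \<in> V"
    and null: "\<And>b i. \<lbrakk>b \<in> V; b \<noteq> 0\<rbrakk> \<Longrightarrow> AE \<omega> in M. b \<bullet> Z i \<omega> \<noteq> 0"
  shows "AE \<omega> in M. dim (range (\<lambda>i. Z i \<omega>)) = min CARD('i) (dim V)"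
proof -
  obtain I :: "'i set" where cI: "card I = min CARD('i) (dim V)"
    using obtain_subset_with_card_n[of "min CARD('i) (dim V)" "UNIV :: 'i set"] by auto
  have "AE \<omega> in M. \<forall>i\<in>I. Z i \<omega> \<notin> span ((\<lambda>j. Z j \<omega>) ` (I - {i}))"
  proof (rule AE_finite_allI)
    fix i assume i: "i \<in> I"
    show "AE \<omega> in M. Z i \<omega> \<notin> span ((\<lambda>j. Z j \<omega>) ` (I - {i}))"
    proof (rule AE_not_in_span_of_indep[OF ind])
      fix W :: "'b set" assume W: "subspace W" "dim W \<le> card (I - {i})"
      have "card (I - {i}) < card I"
        using i by (intro psubset_card_mono) auto
      \<comment> \<open>Leaving out the index \<open>i\<close> makes the inequality strict, also
        when \<open>card I = dim V\<close>.\<close>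
      then have dW: "dim W < dim V"
        using W(2) cI by linarith
      \<comment> \<open>\<open>W\<close> need not lie in \<open>V\<close>, so it is cut down to
        \<open>V\<close>. A nonzero normal \<open>b\<close> of \<open>W \<inter> V\<close> inside
        \<open>V\<close> then exists, and \<open>Z i \<omega> \<in> W\<close> would force
        \<open>b \<bullet> Z i \<omega> = 0\<close>.\<close>
      have "dim (W \<inter> V) < dim V"
        using dim_subset[of "W \<inter> V" W] dW by simp
      then have "span (W \<inter> V) \<subset> span V"
        by (metis Int_lower2 dim_span order_less_irrefl psubsetI span_mono)
      then obtain b where b: "b \<noteq> 0" "b \<in> V" "\<And>y. y \<in> span (W \<inter> V) \<Longrightarrow> orthogonal b y"
        using orthogonal_to_subspace_exists_gen V(1) by (metis span_eq_iff)
      show "AE \<omega> in M. Z i \<omega> \<notin> W"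
        using null[OF b(2,1), of i]
      proof eventually_elim
        case (elim \<omega>)
        then show ?case
          using b(3)[of "Z i \<omega>"] V(2)[of i \<omega>] by (auto simp: orthogonal_def span_base)
      qed
    qed auto
  qed simp
  then show ?thesis
  proof eventually_elim
    case (elim \<omega>)
    define z where "z i = Z i \<omega>" for i
    have z: "z i \<notin> span (z ` (I - {i}))" if "i \<in> I" for i
      using elim that by (simp add: z_def)
    have "inj_on z I"
    proof (rule inj_onI, rule ccontr)
      fix i j assume "i \<in> I" "j \<in> I" "z i = z j" "i \<noteq> j"
      then show False
        using z[of i] by (metis DiffI image_eqI singletonD span_base)
    qed
    moreover from this have "independent (z ` I)"
      using z by (auto simp: dependent_def inj_on_image_set_diff[of z I I])
    ultimately have "card I \<le> dim (range z)"
      by (metis card_image dim_eq_card_independent dim_subset image_mono subset_UNIV)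
    moreover have "dim (range z) \<le> CARD('i)"
      by (meson card_image_le dim_le_card' finite finite_imageI order_trans)
    moreover have "dim (range z) \<le> dim V"
      using V(2) by (intro dim_subset) (auto simp: z_def)
    ultimately show ?case
      using cI by (simp add: z_def)
  qed
qed

section \<open>Zero sets of quadratic forms\<close>

text \<open>All translates of \<open>N\<close> along \<open>v\<close> have the same measure.
  Averaging over them and exchanging the integrals leaves integrals over line sections, which
  vanish; no change of coordinates adapted to \<open>v\<close> is involved.\<close>

lemma null_sets_lborel_of_countable_line_sections:
  fixes N :: "'a::euclidean_space set"
  assumes N [measurable]: "N \<in> sets borel" and line: "\<And>x. countable {t. x + t *\<^sub>R v \<in> N}"
  shows "N \<in> null_sets lborel"
proof -
  have trans: "(\<integral>\<^sup>+x. indicator N (x + t *\<^sub>R v) \<partial>lborel) = emeasure lborel N" for t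
  proof -
    have "emeasure lborel N = (\<integral>\<^sup>+x. indicator N x \<partial>distr lborel borel ((+) (t *\<^sub>R v)))"
      by (simp add: lborel_distr_plus)
    also have "\<dots> = (\<integral>\<^sup>+x. indicator N (x + t *\<^sub>R v) \<partial>lborel)"
      by (subst nn_integral_distr) (auto simp: add.commute)
    finally show ?thesis ..
  qed
  \<comment> \<open>The interval \<open>{0..1}\<close> has length one, so averaging over it
    reproduces the measure of \<open>N\<close>.\<close>
  have "emeasure lborel N = (\<integral>\<^sup>+t. \<integral>\<^sup>+x. indicator {0..1} t * indicator N (x + t *\<^sub>R v) \<partial>lborel \<partial>lborel)"
    by (simp add: nn_integral_cmult trans nn_integral_multc)
  also have "\<dots> = (\<integral>\<^sup>+x. \<integral>\<^sup>+t. indicator {0..1} t * indicator N (x + t *\<^sub>R v) \<partial>lborel \<partial>lborel)"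
    by (rule lborel_pair.Fubini') measurable
  also have "\<dots> = 0"
  proof -
    have "(\<integral>\<^sup>+t. indicator {0..1} t * indicator N (x + t *\<^sub>R v) \<partial>lborel) = 0" for x :: 'a
    proof -
      have "{t. x + t *\<^sub>R v \<in> N} \<in> null_sets lborel"
        by (rule countable_imp_null_set_lborel[OF line])
      then have "AE t in lborel. x + t *\<^sub>R v \<notin> N"
        by (auto dest: AE_not_in)
      then have "(\<integral>\<^sup>+t. indicator {0..1} t * indicator N (x + t *\<^sub>R v) \<partial>lborel)
          = (\<integral>\<^sup>+t. 0 \<partial>(lborel :: real measure))"
        by (intro nn_integral_cong_AE) auto
      then show ?thesis by simp
    qed
    then show ?thesis by simp
  qed
  finally show ?thesis
    by (auto simp: null_sets_def)
qed

text \<open>On every line in direction \<open>v\<close> the form is a quadratic polynomial with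
  leading coefficient \<open>v \<bullet> (B *v v)\<close>, hence has finitely many zeros.\<close>

lemma AE_uniform_sphere_quadratic_form:
  fixes B :: "real^'n^'n"
  assumes v: "v \<bullet> (B *v v) \<noteq> 0"
  shows "AE x in uniform_sphere. x \<bullet> (B *v x) \<noteq> 0"
proof -
  have [measurable]: "(\<lambda>x. x \<bullet> (B *v x)) \<in> borel_measurable borel"
    by (intro borel_measurable_continuous_onI continuous_intros
        linear_continuous_on matrix_vector_mul_bounded_linear)
  have "{x. x \<bullet> (B *v x) = 0} \<in> null_sets lborel"
  proof (rule null_sets_lborel_of_countable_line_sections)
    fix x :: "real^'n"
    define p where "p = [: x \<bullet> (B *v x), x \<bullet> (B *v v) + v \<bullet> (B *v x), v \<bullet> (B *v v) :]"
    have "(x + t *\<^sub>R v) \<bullet> (B *v (x + t *\<^sub>R v)) = poly p t" for t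
      by (simp add: p_def inner_add matrix_vector_right_distrib matrix_vector_mult_scaleR
          algebra_simps power2_eq_square)
    moreover have "p \<noteq> 0"
      using v by (simp add: p_def)
    ultimately show "countable {t. x + t *\<^sub>R v \<in> {x. x \<bullet> (B *v x) = 0}}"
      using poly_roots_finite[of p] by (simp add: countable_finite)
  qed measurable
  then have "AE x in lborel. x \<bullet> (B *v x) \<noteq> 0"
    by (auto dest: AE_not_in)
  \<comment> \<open>The form is homogeneous, and \<open>sgn x\<close> is a positive multiple of
    \<open>x\<close> for \<open>x \<noteq> 0\<close>, so nonvanishing passes to the radial
    projection.\<close>
  then have "AE x in uniform_measure lborel (ball 0 1). sgn x \<bullet> (B *v sgn x) \<noteq> 0"
    by (intro AE_uniform_measureI) (auto simp: sgn_div_norm matrix_vector_mult_scaleR)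
  then show ?thesis
    unfolding uniform_sphere_def by (subst AE_distr_iff) auto
qed

section \<open>Minimal faces and two-sided feasible directions\<close>

text \<open>\<open>L\<close> is the span of the translated face: segments of the face ending at its
  relative interior point \<open>x\<close> can be prolonged beyond \<open>x\<close>, and conversely
  the face absorbs every segment of \<open>S\<close> having \<open>x\<close> in its
  interior.\<close>

lemma aff_dim_minimal_face:
  fixes S :: "'a::euclidean_space set"
  assumes S: "convex S" and x: "x \<in> S"
    and L: "subspace L" "\<And>d. d \<in> L \<longleftrightarrow> (\<exists>e>0. x + e *\<^sub>R d \<in> S \<and> x - e *\<^sub>R d \<in> S)"
  shows "aff_dim (minimal_face S x) = int (dim L)"
proof -
  define F where "F = minimal_face S x"
  have F: "F face_of S" and xF: "x \<in> rel_interior F"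
    using minimal_face[OF S x] by (simp_all add: F_def)
  have FS: "F \<subseteq> S" and cF: "convex F" and xF': "x \<in> F"
    using F xF face_of_imp_convex face_of_imp_subset rel_interior_subset by blast+
  have "(\<lambda>z. z - x) ` F \<subseteq> L"
  proof clarify
    fix z assume z: "z \<in> F"
    then obtain e where e: "e > 1" "(1 - e) *\<^sub>R z + e *\<^sub>R x \<in> F"
      using convex_rel_interior_iff[OF cF] xF by blast
    \<comment> \<open>The point beyond \<open>x\<close> is
      \<open>x - (e - 1) *\<^sub>R (z - x)\<close>. With this \<open>r\<close>, both
      \<open>x + r *\<^sub>R (z - x)\<close> and \<open>x - r *\<^sub>R (z - x)\<close> lie on
      segments from \<open>x\<close> to points of \<open>F\<close>.\<close>
    define r where "r = min 1 (e - 1)"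
    have r: "0 < r" "r \<le> 1" "r \<le> e - 1"
      using e by (auto simp: r_def)
    have "x + r *\<^sub>R (z - x) = (1 - r) *\<^sub>R x + r *\<^sub>R z"
      by (simp add: algebra_simps)
    also have "\<dots> \<in> S"
      using x subsetD[OF FS z] order_less_imp_le[OF r(1)] r(2) by (rule convexD_alt[OF S])
    finally have 1: "x + r *\<^sub>R (z - x) \<in> S" .
    define q where "q = r / (e - 1)"
    have q: "r = q * (e - 1)" "0 \<le> q" "q \<le> 1"
      using e r by (auto simp: q_def)
    have "x - r *\<^sub>R (z - x) = (1 - q) *\<^sub>R x + q *\<^sub>R ((1 - e) *\<^sub>R z + e *\<^sub>R x)"
      by (simp add: q(1) algebra_simps)
    also have "\<dots> \<in> S"
      using x subsetD[OF FS e(2)] q(2,3) by (rule convexD_alt[OF S])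
    finally show "z - x \<in> L"
      using 1 r(1) L(2) by blast
  qed
  moreover have "L \<subseteq> span ((\<lambda>z. z - x) ` F)"
  proof
    fix d assume "d \<in> L"
    then obtain e where e: "0 < e" "x + e *\<^sub>R d \<in> S" "x - e *\<^sub>R d \<in> S"
      using L(2) by blast
    have "x + e *\<^sub>R d \<in> F"
    proof (cases "d = 0")
      case False
      have "2 *\<^sub>R (e *\<^sub>R d) = (x + e *\<^sub>R d) - (x - e *\<^sub>R d)"
        unfolding scaleR_2 by simp
      then have "x + e *\<^sub>R d \<noteq> x - e *\<^sub>R d"
        using False e by force
      moreover have "midpoint (x + e *\<^sub>R d) (x - e *\<^sub>R d) = x"
        by (simp add: midpoint_def flip: scaleR_2)
      ultimately have "x \<in> open_segment (x + e *\<^sub>R d) (x - e *\<^sub>R d)"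
        by (metis midpoint_in_open_segment)
      then show ?thesis
        using F e xF' unfolding face_of_def by blast
    qed (use xF' in simp)
    then have "(x + e *\<^sub>R d) - x \<in> span ((\<lambda>z. z - x) ` F)"
      by (intro span_base imageI)
    then have "(1 / e) *\<^sub>R ((x + e *\<^sub>R d) - x) \<in> span ((\<lambda>z. z - x) ` F)"
      by (rule span_scale)
    then show "d \<in> span ((\<lambda>z. z - x) ` F)"
      using e by simp
  qed
  ultimately have "span ((\<lambda>z. z - x) ` F) = L"
    using L(1) by (meson span_minimal subset_antisym)
  then have "dim ((\<lambda>z. z - x) ` F) = dim L"
    by (metis dim_span)
  moreover have "aff_dim F = int (dim ((\<lambda>z. z - x) ` F))"
    using xF' by (intro aff_dim_eq_dim_subtract hull_inc)
  ultimately show ?thesis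
    by (simp add: F_def)
qed

section \<open>Linear algebra of symmetric matrices\<close>

text \<open>The nonnegative form attains its minimum at \<open>v\<close>, so its gradient vanishes
  there; this is made explicit by moving from \<open>v\<close> in the direction
  \<open>- (A *v v)\<close>.\<close>

lemma psd_matrix_kernel:
  fixes A :: "real^'n^'n"
  assumes A: "transpose A = A" "psd_matrix A" and v: "v \<bullet> (A *v v) = 0"
  shows "A *v v = 0"
proof -
  define w where "w = A *v v"
  have sym: "v \<bullet> (A *v w) = w \<bullet> w"
    using A(1) by (metis dot_lmul_matrix inner_commute vector_transpose_matrix w_def)
  have "0 \<le> (v - t *\<^sub>R w) \<bullet> (A *v (v - t *\<^sub>R w))" for t
    using A(2) by (simp add: psd_matrix_def)
  also have "(v - t *\<^sub>R w) \<bullet> (A *v (v - t *\<^sub>R w)) = t * (t * (w \<bullet> (A *v w)) - 2 * (w \<bullet> w))" for t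
    using v sym by (simp add: inner_diff matrix_vector_mult_diff_distrib
        matrix_vector_mult_scaleR algebra_simps flip: w_def)
  finally have *: "0 \<le> t * (t * (w \<bullet> (A *v w)) - 2 * (w \<bullet> w))" for t .
  have "w \<bullet> w \<le> 0"
  proof (cases "w \<bullet> (A *v w) = 0")
    case True
    then show ?thesis using *[of 1] by simp
  next
    case False
    then have "0 < w \<bullet> (A *v w)"
      using A(2) by (simp add: psd_matrix_def order_less_le)
    then show ?thesis
      \<comment> \<open>The minimiser of the quadratic in \<open>t\<close>, where it is negative
        unless \<open>w = 0\<close>.\<close>
      using *[of "(w \<bullet> w) / (w \<bullet> (A *v w))"]
      by (simp add: zero_le_mult_iff divide_le_0_iff zero_le_divide_iff mult_le_0_iff)
  qed
  then show ?thesis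
    by (metis inner_eq_zero_iff inner_ge_zero order_antisym w_def)
qed

text \<open>The symmetric matrix units, indexed by the sets \<open>{i, j}\<close> of one or two
  indices, have disjoint supports and so form an orthogonal basis. Singletons give the diagonal
  units.\<close>

lemma dim_symmetric_matrices:
  "dim {A :: real^'n^'n. transpose A = A} = CARD('n) + (CARD('n) choose 2)"
proof -
  define P where "P = {s :: 'n set. card s = 1} \<union> {s. card s = 2}"
  define E :: "'n set \<Rightarrow> real^'n^'n" where "E s = (\<chi> i j. of_bool ({i, j} = s))" for s
  have E_nth: "E s $ i $ j = of_bool ({i, j} = s)" for s i j
    by (simp add: E_def)
  have P: "\<exists>i j. s = {i, j}" if "s \<in> P" for s
    using that by (auto simp: P_def card_1_singleton_iff card_2_iff)
  have doubleton: "{i, j} \<in> P" for i j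
    by (cases "i = j") (auto simp: P_def)
  have orth: "E s \<bullet> E t = 0" if "s \<noteq> t" for s t
    using that by (auto simp: inner_vec_def E_nth intro!: sum.neutral)
  have nz: "E s \<noteq> 0" and inj: "E s = E t \<Longrightarrow> s = t" if sP: "s \<in> P" for s t
  proof -
    obtain i j where s: "s = {i, j}"
      using P[OF sP] by blast
    then have 1: "E s $ i $ j = 1"
      by (simp add: E_nth)
    then show "E s \<noteq> 0"
      by auto
    show "s = t" if "E s = E t"
    proof -
      have "of_bool ({i, j} = t) = (1 :: real)"
        using 1 that E_nth[of t i j] by simp
      then show ?thesis
        using s by simp
    qed
  qed
  have "pairwise orthogonal (E ` P)"
    unfolding pairwise_image using orth by (auto simp: pairwise_def orthogonal_def)
  then have "independent (E ` P)"
    using nz by (intro pairwise_orthogonal_independent) auto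
  moreover have "E ` P \<subseteq> {A. transpose A = A}"
    by (auto simp: transpose_def vec_eq_iff E_nth insert_commute)
  moreover have "{A. transpose A = A} \<subseteq> span (E ` P)"
  proof clarify
    fix A :: "real^'n^'n" assume "transpose A = A"
    then have sym: "A $ i $ j = A $ j $ i" for i j
      by (metis transpose_def vec_lambda_beta)
    \<comment> \<open>By symmetry an entry depends only on the unordered pair, so it can serve as a
      coefficient indexed by \<open>s\<close>.\<close>
    have "\<exists>r. \<forall>i j. {i, j} = s \<longrightarrow> A $ i $ j = r" if "s \<in> P" for s
      using P[OF that] sym by (auto simp: doubleton_eq_iff)
    then obtain a where a: "\<And>i j s. s \<in> P \<Longrightarrow> {i, j} = s \<Longrightarrow> A $ i $ j = a s"
      by metis
    have "A = (\<Sum>s\<in>P. a s *\<^sub>R E s)"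
    proof (simp add: vec_eq_iff, intro allI)
      fix i j
      have "(\<Sum>s\<in>P. a s * E s $ i $ j) = (\<Sum>s\<in>P. if s = {i, j} then a s else 0)"
        by (rule sum.cong) (auto simp: E_nth)
      also have "\<dots> = A $ i $ j"
        using a[OF doubleton refl] doubleton by simp
      finally show "A $ i $ j = (\<Sum>s\<in>P. a s * E s $ i $ j)" ..
    qed
    then show "A \<in> span (E ` P)"
      by (simp add: span_sum span_scale span_base)
  qed
  ultimately have "dim {A :: real^'n^'n. transpose A = A} = card (E ` P)"
    by (intro dim_unique) auto
  also have "\<dots> = card P"
    using inj by (intro card_image inj_onI)
  also have "\<dots> = CARD('n) + (CARD('n) choose 2)"
    using n_subsets[of "UNIV :: 'n set" 1] n_subsets[of "UNIV :: 'n set" 2]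
    unfolding P_def by (subst card_Un_disjoint) auto
  finally show ?thesis .
qed

lemma subspace_symmetric_matrices: "subspace {A :: real^'n^'n. transpose A = A}"
  by (auto simp: subspace_def transpose_def vec_eq_iff)

text \<open>The rank-one matrix x x^T; pairing with it makes the value of a quadratic form at
  \<open>x\<close> linear in the form.\<close>

definition outer_square :: "real^'n \<Rightarrow> real^'n^'n"
  where "outer_square x = (\<chi> i j. x $ i * x $ j)"

lemma transpose_outer_square: "transpose (outer_square x) = outer_square x"
  by (simp add: outer_square_def transpose_def vec_eq_iff)

lemma inner_outer_square: "A \<bullet> outer_square x = x \<bullet> (A *v x)"
  by (simp add: outer_square_def inner_vec_def matrix_vector_mult_def sum_distrib_left ac_simps)

lemma inner_congruence:
  fixes Y :: "real^'p^'m"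
  shows "v \<bullet> ((Y ** A ** transpose Y) *v v) = (transpose Y *v v) \<bullet> (A *v (transpose Y *v v))"
  by (metis dot_lmul_matrix inner_commute matrix_vector_mul_assoc transpose_matrix_vector)

lemma diagonal_congruence:
  fixes Y :: "real^'p^'m"
  shows "(Y ** A ** transpose Y) $ i $ i = row i Y \<bullet> (A *v row i Y)"
proof -
  have "X $ i $ i = axis i 1 \<bullet> (X *v axis i 1)" for X :: "real^'m^'m"
    by (simp add: matrix_vector_mult_basis inner_axis' column_def)
  then have "(Y ** A ** transpose Y) $ i $ i
      = axis i 1 \<bullet> ((Y ** A ** transpose Y) *v axis i 1)" .
  also have "\<dots> = (transpose Y *v axis i 1) \<bullet> (A *v (transpose Y *v axis i 1))"
    by (rule inner_congruence)
  finally show ?thesis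
    by (simp add: matrix_vector_mult_basis column_transpose)
qed

lemma transpose_congruence:
  fixes Y :: "real^'p^'m"
  shows "transpose (Y ** A ** transpose Y) = Y ** transpose A ** transpose Y"
  by (simp add: matrix_transpose_mul matrix_mul_assoc)

lemma linear_congruence:
  fixes Y :: "real^'p^'m"
  shows "linear (\<lambda>A. Y ** A ** transpose Y)"
  by (intro linearI) (simp_all add: matrix_matrix_mult_def vec_eq_iff
      sum.distrib sum_distrib_left sum_distrib_right algebra_simps)

lemma inj_congruence:
  fixes Y :: "real^'p^'m" and B :: "real^'m^'p"
  assumes B: "B ** Y = mat 1"
  shows "inj (\<lambda>A. Y ** A ** transpose Y)"
proof (rule inj_on_inverseI)
  have B': "transpose Y ** transpose B = mat 1"
    using B by (metis matrix_transpose_mul transpose_mat)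
  show "B ** (Y ** A ** transpose Y) ** transpose B = A" for A
    by (metis B B' matrix_mul_assoc matrix_mul_lid matrix_mul_rid)
qed

section \<open>Faces of the elliptope at Gram matrices\<close>

lemma gram_in_elliptope:
  fixes Y :: "real^'p^'m"
  assumes "\<And>i. norm (row i Y) = 1"
  shows "Y ** transpose Y \<in> elliptope"
  using assms inner_congruence[of _ Y "mat 1"] diagonal_congruence[of Y "mat 1"]
    transpose_congruence[of Y "mat 1"]
  by (auto simp: elliptope_def psd_matrix_def dot_square_norm)

text \<open>The left inverse \<open>B\<close> expresses full column rank of \<open>Y\<close>. Small
  multiples of a symmetric \<open>A\<close> keep the identity plus or minus \<open>A\<close>
  positive semidefinite; conversely, a two-sided direction vanishes on the kernel of
  \<open>transpose Y\<close> and therefore factors through \<open>Y\<close> on both sides.\<close>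

lemma elliptope_gram_direction_iff:
  fixes Y :: "real^'p^'m" and B :: "real^'m^'p"
  assumes unit: "\<And>i. norm (row i Y) = 1" and B: "B ** Y = mat 1"
  shows "(\<exists>e>0. Y ** transpose Y + e *\<^sub>R D \<in> elliptope \<and> Y ** transpose Y - e *\<^sub>R D \<in> elliptope) \<longleftrightarrow>
    D \<in> (\<lambda>A. Y ** A ** transpose Y) ` {A. transpose A = A \<and> (\<forall>i. A \<bullet> outer_square (row i Y) = 0)}"
    (is "?l \<longleftrightarrow> ?r")
proof
  let ?X = "Y ** transpose Y"
  have X: "transpose ?X = ?X" "\<And>i. ?X $ i $ i = 1"
    using gram_in_elliptope[OF unit] by (simp_all add: elliptope_def)
  have Xv: "v \<bullet> (?X *v v) = (norm (transpose Y *v v))\<^sup>2" for v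
    using inner_congruence[of v Y "mat 1"] by (simp add: dot_square_norm)
  {
    assume ?r
    then obtain A where A: "transpose A = A" "\<And>i. row i Y \<bullet> (A *v row i Y) = 0"
      and D: "D = Y ** A ** transpose Y"
      by (auto simp: inner_outer_square)
    \<comment> \<open>\<open>K\<close> bounds the operator norm of \<open>A\<close>, so steps of
      size \<open>1 / K\<close> in either direction preserve positive semidefiniteness.\<close>
    obtain K where K: "0 < K" "\<And>v. norm (A *v v) \<le> norm v * K"
      using bounded_linear.pos_bounded[OF matrix_vector_mul_bounded_linear[of A]] by blast
    have bound: "\<bar>v \<bullet> (D *v v)\<bar> \<le> K * (norm (transpose Y *v v))\<^sup>2" for v
    proof -
      let ?w = "transpose Y *v v"
      have "\<bar>?w \<bullet> (A *v ?w)\<bar> \<le> norm ?w * (norm ?w * K)"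
        using Cauchy_Schwarz_ineq2[of ?w "A *v ?w"] K(2)[of ?w]
        by (meson mult_left_mono norm_ge_zero order_trans)
      then show ?thesis
        by (simp add: D inner_congruence power2_eq_square mult_ac)
    qed
    have "?X + s *\<^sub>R D \<in> elliptope" if s: "\<bar>s\<bar> = 1 / K" for s
    proof -
      have "transpose (?X + s *\<^sub>R D) = ?X + s *\<^sub>R D"
        using X(1) transpose_congruence[of Y A] A(1)
        by (simp add: D transpose_def vec_eq_iff)
      moreover have "0 \<le> v \<bullet> ((?X + s *\<^sub>R D) *v v)" for v
      proof -
        have "\<bar>s * (v \<bullet> (D *v v))\<bar> \<le> 1 / K * (K * (norm (transpose Y *v v))\<^sup>2)"
          unfolding abs_mult s using bound K(1) by (intro mult_left_mono) auto
        then have "\<bar>s * (v \<bullet> (D *v v))\<bar> \<le> v \<bullet> (?X *v v)"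
          using K(1) by (simp add: Xv)
        then show ?thesis
          by (simp add: matrix_vector_mult_add_rdistrib inner_right_distrib
              flip: scaleR_matrix_vector_assoc)
      qed
      moreover have "(?X + s *\<^sub>R D) $ i $ i = 1" for i
        using X(2) A(2) by (simp add: D diagonal_congruence)
      ultimately show ?thesis
        by (simp add: elliptope_def psd_matrix_def)
    qed
    from this[of "1 / K"] this[of "- (1 / K)"] show ?l
      using K(1) by (intro exI[of _ "1 / K"]) auto
  }
  {
    assume ?l
    then obtain e where e: "0 < e" and pos: "?X + e *\<^sub>R D \<in> elliptope" and neg: "?X - e *\<^sub>R D \<in> elliptope"
      by blast
    have D_sym: "transpose D = D"
    proof -
      have "transpose (?X + e *\<^sub>R D) = transpose ?X + e *\<^sub>R transpose D"
        by (simp add: transpose_def vec_eq_iff)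
      then show ?thesis
        using pos X(1) e by (simp add: elliptope_def)
    qed
    have D_diag: "D $ i $ i = 0" for i
    proof -
      have "(?X + e *\<^sub>R D) $ i $ i = 1"
        using pos by (simp add: elliptope_def)
      then show ?thesis
        using X(2) e by simp
    qed
    have kernel: "D *v v = 0" if v: "transpose Y *v v = 0" for v
    proof -
      have Xv0: "?X *v v = 0"
        using v by (metis matrix_vector_mul_assoc matrix_vector_mult_0_right)
      have "0 \<le> v \<bullet> ((?X + e *\<^sub>R D) *v v)" "0 \<le> v \<bullet> ((?X - e *\<^sub>R D) *v v)"
        using pos neg by (simp_all add: elliptope_def psd_matrix_def)
      \<comment> \<open>The Gram matrix contributes nothing at \<open>v\<close>, so the form of
        \<open>D\<close> is bounded below by zero with both signs.\<close>
      then have "e * (v \<bullet> (D *v v)) = 0"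
        using Xv0 by (simp add: matrix_vector_mult_add_rdistrib matrix_vector_mult_diff_rdistrib
            flip: scaleR_matrix_vector_assoc)
      then have "v \<bullet> ((?X + e *\<^sub>R D) *v v) = 0"
        using Xv0 by (simp add: matrix_vector_mult_add_rdistrib flip: scaleR_matrix_vector_assoc)
      then have "(?X + e *\<^sub>R D) *v v = 0"
        using pos by (intro psd_matrix_kernel) (auto simp: elliptope_def)
      then show ?thesis
        using Xv0 e by (simp add: matrix_vector_mult_add_rdistrib flip: scaleR_matrix_vector_assoc)
    qed
    \<comment> \<open>\<open>transpose B ** transpose Y\<close> is a projection with the same kernel
      as \<open>transpose Y\<close>; it changes \<open>v\<close> only by a kernel vector, which
      \<open>D\<close> annihilates.\<close>
    have "D ** (transpose B ** transpose Y) = D"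
    proof (subst matrix_eq, intro allI)
      fix v
      have "transpose Y ** transpose B = mat 1"
        using B by (metis matrix_transpose_mul transpose_mat)
      then have "transpose Y *v ((transpose B ** transpose Y) *v v) = transpose Y *v v"
        by (metis matrix_mul_assoc matrix_mul_lid matrix_vector_mul_assoc)
      then have "transpose Y *v ((transpose B ** transpose Y) *v v - v) = 0"
        by (simp add: matrix_vector_mult_diff_distrib)
      then have "D *v ((transpose B ** transpose Y) *v v - v) = 0"
        by (rule kernel)
      then show "(D ** (transpose B ** transpose Y)) *v v = D *v v"
        by (simp add: matrix_vector_mult_diff_distrib matrix_vector_mul_assoc)
    qed
    moreover from this have "(Y ** B) ** D = D"
      by (metis D_sym matrix_transpose_mul transpose_transpose)
    ultimately have D: "D = Y ** (B ** D ** transpose B) ** transpose Y"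
      by (simp add: matrix_mul_assoc)
    have "transpose (B ** D ** transpose B) = B ** D ** transpose B"
      by (simp add: transpose_congruence D_sym)
    moreover have "(B ** D ** transpose B) \<bullet> outer_square (row i Y) = 0" for i
      using D_diag[of i] by (metis D diagonal_congruence inner_outer_square)
    ultimately show ?r
      using D by blast
  }
qed

text \<open>Congruence by \<open>Y\<close> is injective, so the face has the dimension of
  \<open>Q\<close>, which is the orthogonal complement of the outer squares within the symmetric
  matrices.\<close>

lemma aff_dim_minimal_face_gram:
  fixes Y :: "real^'p^'m"
  assumes unit: "\<And>i. norm (row i Y) = 1" and full: "span (rows Y) = UNIV"
  shows "aff_dim (minimal_face elliptope (Y ** transpose Y))
      + int (dim (range (\<lambda>i. outer_square (row i Y)))) = int (CARD('p) + (CARD('p) choose 2))"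
proof -
  define Q where "Q = {A. transpose A = A \<and> (\<forall>i. A \<bullet> outer_square (row i Y) = 0)}"
  obtain B :: "real^'m^'p" where B: "B ** Y = mat 1"
    using full matrix_left_invertible_span_rows by blast
  have Q: "subspace Q"
    using subspace_symmetric_matrices unfolding Q_def subspace_def by (auto simp: inner_add_left)
  have "aff_dim (minimal_face elliptope (Y ** transpose Y))
      = int (dim ((\<lambda>A. Y ** A ** transpose Y) ` Q))"
    using elliptope_gram_direction_iff[OF unit B] linear_subspace_image[OF linear_congruence Q]
    by (intro aff_dim_minimal_face convex_elliptope gram_in_elliptope unit) (auto simp: Q_def)
  also have "\<dots> = int (dim Q)"
    using inj_congruence[OF B] by (simp add: dim_image_eq[OF linear_congruence] inj_on_subset)
  finally have face: "aff_dim (minimal_face elliptope (Y ** transpose Y)) = int (dim Q)" .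
  let ?R = "range (\<lambda>i. outer_square (row i Y))"
  have "span ?R \<subseteq> {A. transpose A = A}"
    by (intro span_minimal subspace_symmetric_matrices) (auto simp: transpose_outer_square)
  then have "dim {A \<in> {A. transpose A = A}. \<forall>x\<in>span ?R. orthogonal x A} + dim (span ?R)
      = dim {A :: real^'p^'p. transpose A = A}"
    by (intro dim_subspace_orthogonal_to_vectors subspace_span subspace_symmetric_matrices)
  moreover have "{A \<in> {A. transpose A = A}. \<forall>x\<in>span ?R. orthogonal x A} = Q"
  proof -
    have "(\<forall>x\<in>span ?R. orthogonal x A) \<longleftrightarrow> (\<forall>i. A \<bullet> outer_square (row i Y) = 0)" for A
    proof
      assume "\<forall>x\<in>span ?R. orthogonal x A"
      then show "\<forall>i. A \<bullet> outer_square (row i Y) = 0"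
        by (auto simp: orthogonal_def inner_commute span_base)
    next
      assume "\<forall>i. A \<bullet> outer_square (row i Y) = 0"
      then have "orthogonal A y" if "y \<in> ?R" for y
        using that by (auto simp: orthogonal_def)
      then show "\<forall>x\<in>span ?R. orthogonal x A"
        using orthogonal_to_span[of _ ?R A] unfolding orthogonal_commute[of A] by blast
    qed
    then show ?thesis
      by (auto simp: Q_def)
  qed
  ultimately show ?thesis
    using face by (simp add: dim_symmetric_matrices)
qed

section \<open>Uniform rows and the almost sure dimension\<close>

lemma outer_square_mult_vec: "outer_square b *v x = (b \<bullet> x) *\<^sub>R b"
  by (simp add: outer_square_def matrix_vector_mult_def inner_vec_def vec_eq_iff
      sum_distrib_left ac_simps)

text \<open>The square of \<open>b \<bullet> x\<close> is the quadratic form of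
  \<open>outer_square b\<close>, which is nonzero at \<open>b\<close> itself.\<close>

lemma AE_uniform_sphere_inner:
  fixes b :: "real^'n"
  assumes "b \<noteq> 0"
  shows "AE x in uniform_sphere. b \<bullet> x \<noteq> 0"
proof -
  have "AE x in uniform_sphere. x \<bullet> (outer_square b *v x) \<noteq> 0"
    using assms by (intro AE_uniform_sphere_quadratic_form[of b]) (simp add: outer_square_mult_vec)
  then show ?thesis
    by eventually_elim (auto simp: outer_square_mult_vec)
qed

text \<open>If the form of \<open>B\<close> vanished identically, \<open>B\<close> would be positive
  semidefinite with every vector in its kernel, hence zero.\<close>

lemma AE_uniform_sphere_inner_outer_square:
  fixes B :: "real^'n^'n"
  assumes B: "transpose B = B" "B \<noteq> 0"
  shows "AE x in uniform_sphere. B \<bullet> outer_square x \<noteq> 0"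
proof -
  have "\<exists>v. v \<bullet> (B *v v) \<noteq> 0"
  proof (rule ccontr)
    assume "\<not> ?thesis"
    then have "B *v v = 0" for v
      using B(1) by (intro psd_matrix_kernel) (auto simp: psd_matrix_def)
    then show False
      using B(2) by (metis matrix_eq matrix_vector_mult_0)
  qed
  then show ?thesis
    using AE_uniform_sphere_quadratic_form by (auto simp: inner_outer_square)
qed

lemma borel_measurable_outer_square [measurable]: "outer_square \<in> borel_measurable borel"
  unfolding outer_square_def
  by (intro borel_measurable_continuous_onI continuous_on_vec_lambda continuous_intros)

lemma two_mult_add_choose_two: "2 * (n + (n choose 2)) = n * (n + 1)"
  by (induction n) (simp_all add: numeral_2_eq_2 algebra_simps)

text \<open>Only the law of \<open>Y\<close> is prescribed, so unit rows are themselves an almost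
  sure event, to be intersected with the two general position events.\<close>

theorem theoremB1:
  fixes M :: "'w measure" and Y :: "'w \<Rightarrow> real^'p^'m"
  assumes "prob_space M"
    and "CARD('p) \<le> CARD('m)"
    and "prob_space.indep_vars M (\<lambda>_. borel) (\<lambda>i \<omega>. row i (Y \<omega>)) UNIV"
    and "\<And>i. distr M borel (\<lambda>\<omega>. row i (Y \<omega>)) = uniform_sphere"
  shows "AE \<omega> in M. real_of_int (aff_dim (minimal_face elliptope (Y \<omega> ** transpose (Y \<omega>))))
           = max 0 (real CARD('p) * (real CARD('p) + 1) / 2 - real CARD('m))"
proof -
  interpret prob_space M by fact
  have rv: "(\<lambda>\<omega>. row i (Y \<omega>)) \<in> borel_measurable M" for i
    using assms(3) by (simp add: indep_vars_def)
  have transfer: "AE \<omega> in M. P (row i (Y \<omega>))" if "AE x in uniform_sphere. P x" for P i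
    using AE_distrD[OF rv[of i]] that assms(4)[of i] by metis
  have "AE \<omega> in M. \<forall>i\<in>UNIV. norm (row i (Y \<omega>)) = 1"
    by (intro AE_finite_allI transfer AE_uniform_sphere_norm) simp
  moreover have "AE \<omega> in M. dim (range (\<lambda>i. row i (Y \<omega>))) = min CARD('m) (dim (UNIV :: (real^'p) set))"
    using assms(3) by (rule AE_dim_range_indep) (auto intro!: transfer AE_uniform_sphere_inner)
  moreover have "AE \<omega> in M. dim (range (\<lambda>i. outer_square (row i (Y \<omega>))))
      = min CARD('m) (dim {A :: real^'p^'p. transpose A = A})"
  proof (rule AE_dim_range_indep)
    show "indep_vars (\<lambda>_. borel) (\<lambda>i \<omega>. outer_square (row i (Y \<omega>))) UNIV"
      using assms(3) by (rule indep_vars_compose2) simp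
    show "AE \<omega> in M. B \<bullet> outer_square (row i (Y \<omega>)) \<noteq> 0"
      if "B \<in> {A. transpose A = A}" "B \<noteq> 0" for B i
      using that by (intro transfer AE_uniform_sphere_inner_outer_square) auto
  qed (auto simp: subspace_symmetric_matrices transpose_outer_square)
  ultimately show ?thesis
  proof eventually_elim
    case (elim \<omega>)
    have "rows (Y \<omega>) = range (\<lambda>i. row i (Y \<omega>))"
      by (auto simp: rows_def)
    then have full: "span (rows (Y \<omega>)) = UNIV"
      \<comment> \<open>Here \<open>CARD('p) \<le> CARD('m)\<close> makes the minimum equal to
        \<open>CARD('p)\<close>, giving full column rank.\<close>
      using elim(2) assms(2) by (simp flip: dim_eq_full)
    have half: "2 * (real CARD('p) + real (CARD('p) choose 2)) = real CARD('p) * (real CARD('p) + 1)"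
      using arg_cong[OF two_mult_add_choose_two[of "CARD('p)"], of real] by (simp add: algebra_simps)
    have "aff_dim (minimal_face elliptope (Y \<omega> ** transpose (Y \<omega>)))
        + int (min CARD('m) (CARD('p) + (CARD('p) choose 2))) = int (CARD('p) + (CARD('p) choose 2))"
      using aff_dim_minimal_face_gram[OF _ full] elim(1) unfolding elim(3) dim_symmetric_matrices by blast
    \<comment> \<open>With N = p(p+1)/2 the face dimension is N - min(m, N) = max(0, N - m).\<close>
    from arg_cong[OF this, of real_of_int]
    have "real_of_int (aff_dim (minimal_face elliptope (Y \<omega> ** transpose (Y \<omega>))))
        + min (real CARD('m)) (real CARD('p) + real (CARD('p) choose 2))
        = real CARD('p) + real (CARD('p) choose 2)"
      by (simp add: of_nat_min)
    then show ?case
      using half by (simp add: max_def min_def split: if_splits)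
  qed
qed

end
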